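(* Let $n\ge 2$, let $t\in\mathbb{R}$ with $1\le t<\sqrt n$, and let $\mathbf v\in\mathbb{R}^n$. Then: (i) If $I_1>t^2$, then $\phi(\lambda)>0$ for any $\lambda\in(-\infty,v_{\max})$. (ii) If $I_1=t^2$, then $\phi(\lambda)>0$ for any $\lambda\in(-\infty,\lambda_2)$ and $\phi(\lambda)=0$ for any $\lambda\in[\lambda_2,v_{\max})$. (iii) If $I_1<t^2$, then $\phi(\lambda)=0$ possesses a unique root on $(-\infty,v_{\max})$, and this root lies in $(-\infty,\lambda_{j_t})$. Furthermore, $\phi(\lambda)=0$ possesses a unique root on $(0,v_{\max})$ if and only if $\phi(0)>0$.
   Context: $v_{\max}=\max_i v_i$. Let $\lambda_1>\lambda_2>\dots>\lambda_k$ be the distinct values among the components of $\mathbf v$ (so $\lambda_1=v_{\max}$). For $j=1,\dots,k$ let $I_j=|\{i: v_i\ge\lambda_j\}|$ (so $I_k=n$), and let $j_t=\min\{j\in\{1,\dots,k\}: I_j\ge t^2\}$. (In case (ii), $I_1=t^2<n$ forces $k\ge 2$, so $\lambda_2$ exists.) With $\mathbf 1$ the all-ones vector and $\mathbf y^+=\max(\mathbf y,0)$ componentwise, define for $\lambda\in\mathbb{R}$ $$\phi(\lambda)=\|(\mathbf v-\lambda\mathbf 1)^+\|_1^2-t^2\|(\mathbf v-\lambda\mathbf 1)^+\|_2^2 .$$ *)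

theory Defs
  imports "HOL-Analysis.Analysis"
begin

definition l1norm :: "real ^ 'n \<Rightarrow> real"
  where "l1norm y = (\<Sum>i\<in>UNIV. \<bar>y $ i\<bar>)"

definition pos_part :: "real ^ 'n \<Rightarrow> real ^ 'n"
  where "pos_part y = (\<chi> i. max (y $ i) 0)"

(* The 2-norm is the norm of the type real ^ 'n; "1" is the all-ones vector. *)
definition phi :: "real \<Rightarrow> real ^ 'n \<Rightarrow> real \<Rightarrow> real"
  where "phi t v \<mu> =
    (l1norm (pos_part (v - \<mu> *\<^sub>R 1)))\<^sup>2 - t\<^sup>2 * (norm (pos_part (v - \<mu> *\<^sub>R 1)))\<^sup>2"

definition vmax :: "real ^ 'n \<Rightarrow> real"
  where "vmax v = Max (range (\<lambda>i. v $ i))"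

definition num_vals :: "real ^ 'n \<Rightarrow> nat"
  where "num_vals v = card (range (\<lambda>i. v $ i))"

(* The j-th largest distinct component of v, with j counted from 1; meaningful only for
   1 \<le> j \<le> num_vals v. *)
definition lam :: "real ^ 'n \<Rightarrow> nat \<Rightarrow> real"
  where "lam v j = rev (sorted_list_of_set (range (\<lambda>i. v $ i))) ! (j - 1)"

definition Icount :: "real ^ 'n \<Rightarrow> nat \<Rightarrow> nat"
  where "Icount v j = card {i. v $ i \<ge> lam v j}"

(* The set is nonempty whenever t\<^sup>2 \<le> CARD('n), since Icount v (num_vals v) = CARD('n). *)
definition jt :: "real \<Rightarrow> real ^ 'n \<Rightarrow> nat"
  where "jt t v = Min {j \<in> {1..num_vals v}. real (Icount v j) \<ge> t\<^sup>2}"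

lemma lam_strict_decreasing:
  fixes v :: "real ^ 'n"
  assumes "1 \<le> i" "i < j" "j \<le> num_vals v"
  shows "lam v j < lam v i"
proof -
  let ?xs = "sorted_list_of_set (range (\<lambda>i. v $ i))"
  have len: "length ?xs = num_vals v"
    by (simp add: num_vals_def)
  have "sorted_wrt (<) ?xs"
    by (rule strict_sorted_list_of_set)
  then have "?xs ! (length ?xs - j) < ?xs ! (length ?xs - i)"
    by (rule sorted_wrt_nth_less) (use assms len in auto)
  then show ?thesis
    using assms len by (simp add: lam_def rev_nth)
qed

lemma lam_image:
  fixes v :: "real ^ 'n"
  shows "lam v ` {1..num_vals v} = range (\<lambda>i. v $ i)"
proof -
  let ?xs = "rev (sorted_list_of_set (range (\<lambda>i. v $ i)))"
  have len: "length ?xs = num_vals v"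
    by (simp add: num_vals_def)
  have "lam v ` {1..num_vals v} = (\<lambda>j. ?xs ! j) ` ((\<lambda>j. j - 1) ` {1..num_vals v})"
    by (simp add: image_image lam_def)
  also have "(\<lambda>j. j - 1) ` {1..num_vals v} = {0..<length ?xs}"
    unfolding len by (auto simp: image_iff intro!: bexI[of _ "Suc _"])
  also have "(\<lambda>j. ?xs ! j) ` {0..<length ?xs} = set ?xs"
    by (subst nth_image) simp_all
  also have "\<dots> = range (\<lambda>i. v $ i)"
    by simp
  finally show ?thesis .
qed

end

theory Submission
  imports Defs
begin

text \<open>
  Write \<open>S\<close> and \<open>Q\<close> for the sum and the sum of squares of the excesses \<open>(v\<^sub>i - \<mu>)\<^sup>+\<close>, so that
  \<open>\<phi> = S\<^sup>2 - t\<^sup>2 Q\<close>. Below \<open>v\<^sub>m\<^sub>a\<^sub>x\<close> both are positive, and the sign of \<open>\<phi>\<close> compares the participation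
  ratio \<open>S\<^sup>2 / Q\<close> of the excesses with \<open>t\<^sup>2\<close>. The proof rests on one fact: this ratio is nonincreasing as
  \<open>\<mu>\<close> grows, and it decreases strictly as long as some component lies strictly between \<open>\<mu>\<close> and
  \<open>v\<^sub>m\<^sub>a\<^sub>x\<close>. It is proved in the denominator-free form \<open>\<phi>(\<mu>) Q(\<mu>') \<le> \<phi>(\<mu>') Q(\<mu>)\<close> for
  \<open>\<mu>' < \<mu>\<close> (lemmas \<open>phi_cross_mono\<close> and \<open>phi_cross_strict\<close>), which also determines the signs.

  Three evaluations of the ratio complete the argument. When only the maximal components exceed \<open>\<mu>\<close>,
  the excesses are all equal and the ratio is exactly \<open>I\<^sub>1\<close> (\<open>phi_top_level\<close>); monotonicity then
  settles the cases \<open>I\<^sub>1 \<ge> t\<^sup>2\<close>. By the Cauchy-Schwarz inequality the ratio is at most the number of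
  components exceeding \<open>\<mu>\<close>, which is less than \<open>t\<^sup>2\<close> for \<open>\<mu> \<ge> \<lambda>\<^bsub>j\<^sub>t\<^esub>\<close>, so \<open>\<phi>\<close> is negative there
  (\<open>phi_neg_if_few_exceed\<close>). As \<open>\<mu>\<close> tends to \<open>-\<infinity>\<close> the excesses become nearly equal and the ratio
  tends to \<open>n > t\<^sup>2\<close> (\<open>phi_pos_somewhere\<close>). So when \<open>I\<^sub>1 < t\<^sup>2\<close> there is a root by continuity,
  necessarily below \<open>\<lambda>\<^bsub>j\<^sub>t\<^esub>\<close>, where strict monotonicity makes it unique and makes \<open>\<phi>\<close> change sign
  from positive to negative; comparing the root with \<open>0\<close> gives the last claim.
\<close>

section \<open>The excesses over a threshold\<close>

definition excess :: "real ^ 'n \<Rightarrow> real \<Rightarrow> 'n \<Rightarrow> real"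
  where "excess v \<mu> i = max (v $ i - \<mu>) 0"

definition excess_sum :: "real ^ 'n \<Rightarrow> real \<Rightarrow> real"
  where "excess_sum v \<mu> = (\<Sum>i\<in>UNIV. excess v \<mu> i)"

definition excess_sq :: "real ^ 'n \<Rightarrow> real \<Rightarrow> real"
  where "excess_sq v \<mu> = (\<Sum>i\<in>UNIV. (excess v \<mu> i)\<^sup>2)"

lemma phi_eq: "phi t v \<mu> = (excess_sum v \<mu>)\<^sup>2 - t\<^sup>2 * excess_sq v \<mu>"
proof -
  have comp: "pos_part (v - \<mu> *\<^sub>R 1) $ i = excess v \<mu> i" for i
    by (simp add: pos_part_def excess_def)
  have nonneg: "excess v \<mu> i \<ge> 0" for i
    by (simp add: excess_def)
  have "(norm (pos_part (v - \<mu> *\<^sub>R 1)))\<^sup>2 = excess_sq v \<mu>"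
    by (simp add: norm_vec_def L2_set_def comp excess_sq_def sum_nonneg)
  then show ?thesis
    by (simp add: phi_def l1norm_def comp nonneg excess_sum_def)
qed

lemma continuous_on_phi: "continuous_on A (phi t v)"
  unfolding phi_eq excess_sum_def excess_sq_def excess_def
  by (intro continuous_intros)

lemma vmax_ge: "v $ i \<le> vmax v"
  by (simp add: vmax_def)

lemma vmax_attained: obtains i where "v $ i = vmax v"
proof -
  have "vmax v \<in> range (\<lambda>i. v $ i)"
    unfolding vmax_def by (intro Max_in) auto
  with that show thesis by auto
qed

lemma excess_sum_pos:
  assumes "\<mu> < vmax v" shows "excess_sum v \<mu> > 0"
proof -
  obtain i where "v $ i = vmax v" by (rule vmax_attained)
  with assms show ?thesis
    unfolding excess_sum_def by (intro sum_pos2[of _ i]) (auto simp: excess_def)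
qed

lemma excess_sq_pos:
  assumes "\<mu> < vmax v" shows "excess_sq v \<mu> > 0"
proof -
  obtain i where "v $ i = vmax v" by (rule vmax_attained)
  with assms show ?thesis
    unfolding excess_sq_def by (intro sum_pos2[of _ i]) (auto simp: excess_def)
qed

lemma phi_zero_above:
  assumes "vmax v \<le> \<mu>" shows "phi t v \<mu> = 0"
proof -
  have "v $ i \<le> \<mu>" for i using vmax_ge[of v i] assms by simp
  then show ?thesis by (simp add: phi_eq excess_sum_def excess_sq_def excess_def max_def)
qed

section \<open>Monotonicity of the participation ratio\<close>

text \<open>The defect in the weighted Cauchy-Schwarz inequality, as a sum of squares; from it the
  strict case can be read off.\<close>

lemma weighted_variance:
  fixes a c :: "'a \<Rightarrow> real"
  shows "2 * ((\<Sum>i\<in>A. c i) * (\<Sum>i\<in>A. c i * (a i)\<^sup>2) - (\<Sum>i\<in>A. c i * a i)\<^sup>2)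
         = (\<Sum>i\<in>A. \<Sum>j\<in>A. c i * c j * (a i - a j)\<^sup>2)"
proof -
  have "(\<Sum>i\<in>A. \<Sum>j\<in>A. c i * c j * (a i - a j)\<^sup>2)
      = (\<Sum>i\<in>A. \<Sum>j\<in>A. c i * (c j * (a j)\<^sup>2) + (c i * (a i)\<^sup>2) * c j
          - 2 * ((c i * a i) * (c j * a j)))"
    by (intro sum.cong refl) (simp add: power2_eq_square algebra_simps)
  also have "\<dots> = (\<Sum>i\<in>A. c i) * (\<Sum>j\<in>A. c j * (a j)\<^sup>2)
      + (\<Sum>i\<in>A. c i * (a i)\<^sup>2) * (\<Sum>j\<in>A. c j) - 2 * ((\<Sum>i\<in>A. c i * a i) * (\<Sum>j\<in>A. c j * a j))"
    by (simp only: sum.distrib sum_subtractf sum_product) (simp only: sum_distrib_left)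
  finally show ?thesis by (simp add: power2_eq_square)
qed

text \<open>Lowering the threshold from \<open>\<mu>\<close> to \<open>\<mu>'\<close> adds to each excess \<open>a\<^sub>i\<close> an amount \<open>c\<^sub>i \<le> \<mu> - \<mu>'\<close>, with
  equality wherever the excess over \<open>\<mu>\<close> is positive. Hence \<open>\<Sum> a\<^sub>i c\<^sub>i = (\<mu> - \<mu>') S(\<mu>)\<close>, and the
  \<open>c\<close>-weighted Cauchy-Schwarz inequality bounds the resulting change of the ratio. It is strict as
  soon as two excesses with positive weight differ.\<close>

lemma excess_cross:
  assumes "\<mu>' < \<mu>" "\<mu> < vmax v"
  shows "(excess_sum v \<mu>)\<^sup>2 * excess_sq v \<mu>' \<le> (excess_sum v \<mu>')\<^sup>2 * excess_sq v \<mu>"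
    and "\<mu>' < v $ k \<Longrightarrow> v $ k < vmax v \<Longrightarrow>
      (excess_sum v \<mu>)\<^sup>2 * excess_sq v \<mu>' < (excess_sum v \<mu>')\<^sup>2 * excess_sq v \<mu>"
proof -
  define a where "a = excess v \<mu>"
  define c where "c i = excess v \<mu>' i - a i" for i
  define d where "d = \<mu> - \<mu>'"
  define S where "S = (\<Sum>i\<in>UNIV. a i)"
  define Q where "Q = (\<Sum>i\<in>UNIV. (a i)\<^sup>2)"
  define C where "C = (\<Sum>i\<in>UNIV. c i)"
  define R where "R = (\<Sum>i\<in>UNIV. (c i)\<^sup>2)"
  define V where "V = (\<Sum>i\<in>UNIV. \<Sum>j\<in>UNIV. c i * c j * (a i - a j)\<^sup>2)"
  have d: "d > 0" using assms by (simp add: d_def)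
  have c: "0 \<le> c i" "c i \<le> d" for i
    using assms by (auto simp: c_def a_def d_def excess_def)
  have ca: "c i * a i = d * a i" for i
    using assms by (auto simp: c_def a_def d_def excess_def max_def)
  have S: "S > 0" using excess_sum_pos[OF assms(2)] by (simp add: S_def a_def excess_sum_def)
  have C0: "C \<ge> 0" unfolding C_def by (intro sum_nonneg c)
  have R: "R \<le> d * C"
    unfolding R_def C_def sum_distrib_left power2_eq_square
    by (intro sum_mono mult_right_mono c)
  have "(\<Sum>i\<in>UNIV. c i * (a i)\<^sup>2) = d * Q"
    unfolding Q_def sum_distrib_left
    by (intro sum.cong refl) (simp add: power2_eq_square ca flip: mult.assoc)
  moreover have ca_sum: "(\<Sum>i\<in>UNIV. c i * a i) = d * S"
    by (simp add: S_def sum_distrib_left ca)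
  ultimately have V: "V = 2 * d * (C * Q - d * S\<^sup>2)"
    using weighted_variance[of c UNIV a] by (simp add: V_def C_def power2_eq_square algebra_simps)
  have V0: "V \<ge> 0" unfolding V_def by (intro sum_nonneg mult_nonneg_nonneg c) auto
  have cauchy: "d * S\<^sup>2 \<le> C * Q"
    using V0 d unfolding V by (simp add: zero_le_mult_iff)
  have S': "excess_sum v \<mu>' = S + C"
    by (simp add: excess_sum_def S_def C_def c_def flip: sum.distrib)
  have "excess_sq v \<mu>' = (\<Sum>i\<in>UNIV. (a i)\<^sup>2 + 2 * (c i * a i) + (c i)\<^sup>2)"
    unfolding excess_sq_def
    by (intro sum.cong refl) (simp add: c_def power2_eq_square algebra_simps)
  also have "\<dots> = Q + 2 * (d * S) + R"
    unfolding sum.distrib by (simp add: Q_def R_def ca_sum flip: sum_distrib_left)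
  finally have Q': "excess_sq v \<mu>' = Q + 2 * (d * S) + R" .
  have SQ: "excess_sum v \<mu> = S" "excess_sq v \<mu> = Q"
    by (simp_all add: excess_sum_def excess_sq_def S_def Q_def a_def)
  have diff: "(S + C)\<^sup>2 * Q - S\<^sup>2 * (Q + 2 * (d * S) + R)
      = 2 * S * (C * Q - d * S\<^sup>2) + (C * (C * Q) - S\<^sup>2 * R)"
    by (simp add: power2_eq_square algebra_simps)
  have "S\<^sup>2 * R \<le> S\<^sup>2 * (d * C)"
    by (intro mult_left_mono R) simp
  also have "\<dots> = C * (d * S\<^sup>2)" by (simp add: algebra_simps)
  also have "\<dots> \<le> C * (C * Q)"
    by (intro mult_left_mono cauchy C0)
  finally have rest: "C * (C * Q) - S\<^sup>2 * R \<ge> 0" by simp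
  have "2 * S * (C * Q - d * S\<^sup>2) \<ge> 0"
    using S cauchy by simp
  with diff rest show "(excess_sum v \<mu>)\<^sup>2 * excess_sq v \<mu>' \<le> (excess_sum v \<mu>')\<^sup>2 * excess_sq v \<mu>"
    unfolding S' Q' SQ by linarith
  assume k: "\<mu>' < v $ k" "v $ k < vmax v"
  obtain m where m: "v $ m = vmax v" by (rule vmax_attained)
  have "c m > 0" "c k > 0" "a k < a m"
    using assms k m by (auto simp: c_def a_def excess_def)
  then have "0 < c k * c m * (a k - a m)\<^sup>2" by simp
  also have "\<dots> \<le> (\<Sum>j\<in>UNIV. c k * c j * (a k - a j)\<^sup>2)"
    by (rule member_le_sum) (auto simp: c)
  also have "\<dots> \<le> V"
    unfolding V_def
    by (rule member_le_sum[where f = "\<lambda>i. \<Sum>j\<in>UNIV. c i * c j * (a i - a j)\<^sup>2"])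
       (auto simp: c intro!: sum_nonneg)
  finally have "d * S\<^sup>2 < C * Q"
    using d unfolding V by (simp add: zero_less_mult_iff)
  then have "2 * S * (C * Q - d * S\<^sup>2) > 0"
    using S by simp
  with diff rest show "(excess_sum v \<mu>)\<^sup>2 * excess_sq v \<mu>' < (excess_sum v \<mu>')\<^sup>2 * excess_sq v \<mu>"
    unfolding S' Q' SQ by linarith
qed

lemma phi_cross_mono:
  assumes "\<mu>' < \<mu>" "\<mu> < vmax v"
  shows "phi t v \<mu> * excess_sq v \<mu>' \<le> phi t v \<mu>' * excess_sq v \<mu>"
  using excess_cross(1)[OF assms] by (simp add: phi_eq algebra_simps)

lemma phi_cross_strict:
  assumes "\<mu>' < \<mu>" "\<mu> < vmax v" "\<mu>' < v $ k" "v $ k < vmax v"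
  shows "phi t v \<mu> * excess_sq v \<mu>' < phi t v \<mu>' * excess_sq v \<mu>"
  using excess_cross(2)[OF assms] by (simp add: phi_eq algebra_simps)

lemma phi_pos_leftward:
  assumes "\<mu>' < \<mu>" "\<mu> < vmax v" "phi t v \<mu> > 0"
  shows "phi t v \<mu>' > 0"
proof -
  have "0 < phi t v \<mu> * excess_sq v \<mu>'"
    using assms by (simp add: excess_sq_pos)
  also have "\<dots> \<le> phi t v \<mu>' * excess_sq v \<mu>"
    by (rule phi_cross_mono[OF assms(1,2)])
  finally show ?thesis
    using excess_sq_pos[OF assms(2)] by (simp add: zero_less_mult_iff)
qed

lemma phi_pos_left_of_nonneg:
  assumes "\<mu>' < \<mu>" "\<mu> < vmax v" "\<mu>' < v $ k" "v $ k < vmax v" "phi t v \<mu> \<ge> 0"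
  shows "phi t v \<mu>' > 0"
proof -
  have "0 \<le> phi t v \<mu> * excess_sq v \<mu>'"
    using assms excess_sq_pos[of \<mu>' v] by simp
  also have "\<dots> < phi t v \<mu>' * excess_sq v \<mu>"
    by (rule phi_cross_strict[OF assms(1-4)])
  finally show ?thesis
    using excess_sq_pos[OF assms(2)] by (simp add: zero_less_mult_iff)
qed

section \<open>Evaluating the participation ratio\<close>

text \<open>The second assumption says that only the maximal components exceed \<open>\<mu>\<close>; then \<open>S\<close> is their
  number times \<open>v\<^sub>m\<^sub>a\<^sub>x - \<mu>\<close>, and \<open>Q\<close> is their number times its square.\<close>

lemma phi_top_level:
  fixes v :: "real ^ 'n"
  assumes "\<mu> \<le> vmax v" "\<And>i. v $ i < vmax v \<Longrightarrow> v $ i \<le> \<mu>"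
  defines "N \<equiv> real (card {i. v $ i \<ge> vmax v})"
  shows "phi t v \<mu> = (vmax v - \<mu>)\<^sup>2 * N * (N - t\<^sup>2)"
proof -
  let ?M = "{i. v $ i \<ge> vmax v}"
  have ex: "excess v \<mu> i = (if i \<in> ?M then vmax v - \<mu> else 0)" for i
    using assms(1) assms(2)[of i] vmax_ge[of v i] by (auto simp: excess_def)
  have "excess_sum v \<mu> = N * (vmax v - \<mu>)"
    unfolding excess_sum_def ex N_def by (simp add: sum.If_cases)
  moreover have "excess_sq v \<mu> = N * (vmax v - \<mu>)\<^sup>2"
    unfolding excess_sq_def ex N_def if_distrib[of "\<lambda>x. x\<^sup>2"] by (simp add: sum.If_cases)
  ultimately have "phi t v \<mu> = (N * (vmax v - \<mu>))\<^sup>2 - t\<^sup>2 * (N * (vmax v - \<mu>)\<^sup>2)"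
    by (simp add: phi_eq)
  also have "\<dots> = (vmax v - \<mu>)\<^sup>2 * N * (N - t\<^sup>2)"
    by (simp add: power2_eq_square algebra_simps)
  finally show ?thesis .
qed

text \<open>The Cauchy-Schwarz inequality over the components exceeding \<open>\<mu>\<close>, the only ones that
  contribute, gives \<open>S\<^sup>2 \<le> N Q\<close> with \<open>N\<close> their number.\<close>

lemma phi_neg_if_few_exceed:
  fixes v :: "real ^ 'n"
  assumes "\<mu> < vmax v" "real (card {i. v $ i > \<mu>}) < t\<^sup>2"
  shows "phi t v \<mu> < 0"
proof -
  let ?P = "{i. v $ i > \<mu>}"
  have "excess_sum v \<mu> = (\<Sum>i\<in>?P. excess v \<mu> i)"
    unfolding excess_sum_def by (rule sum.mono_neutral_right) (auto simp: excess_def)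
  moreover have "excess_sq v \<mu> = (\<Sum>i\<in>?P. (excess v \<mu> i)\<^sup>2)"
    unfolding excess_sq_def by (rule sum.mono_neutral_right) (auto simp: excess_def)
  ultimately have "(excess_sum v \<mu>)\<^sup>2 \<le> excess_sq v \<mu> * real (card ?P)"
    using Cauchy_Schwarz_ineq_sum[where a = "excess v \<mu>" and b = "\<lambda>_. 1" and I = ?P] by simp
  also have "\<dots> < excess_sq v \<mu> * t\<^sup>2"
    by (intro mult_strict_left_mono assms(2) excess_sq_pos[OF assms(1)])
  finally show ?thesis by (simp add: phi_eq mult.commute)
qed

text \<open>At distance \<open>r\<close> below the least component all excesses lie between \<open>r\<close> and \<open>r + D\<close>, where \<open>D\<close>
  is the spread of \<open>v\<close>. So \<open>S \<ge> n r\<close> and \<open>Q \<le> n (r + D)\<^sup>2\<close>, and it suffices to choose \<open>r\<close> with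
  \<open>\<surd>n r > t (r + D)\<close>.\<close>

lemma phi_pos_somewhere:
  fixes v :: "real ^ 'n"
  assumes "0 \<le> t" "t < sqrt (real CARD('n))"
  obtains \<mu> where "\<mu> < v $ k" "phi t v \<mu> > 0"
proof -
  define n where "n = real CARD('n)"
  define l where "l = Min (range (\<lambda>i. v $ i))"
  define D where "D = vmax v - l"
  define r where "r = t * D / (sqrt n - t) + 1"
  have n: "n > 0" by (simp add: n_def)
  have l: "l \<le> v $ i" for i by (simp add: l_def)
  have D: "D \<ge> 0" using l[of k] vmax_ge[of v k] by (simp add: D_def)
  have gap: "sqrt n - t > 0" using assms(2) by (simp add: n_def)
  have r: "r > 0" using D gap assms(1) by (simp add: r_def add_nonneg_pos)
  have "r * (sqrt n - t) = t * D + (sqrt n - t)"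
    using gap by (simp add: r_def field_simps)
  then have key: "t * (r + D) < r * sqrt n"
    using gap by (simp add: algebra_simps)
  have ex: "r \<le> excess v (l - r) i" "excess v (l - r) i \<le> r + D" for i
    using l[of i] vmax_ge[of v i] r by (auto simp: excess_def D_def)
  have "(\<Sum>i\<in>(UNIV::'n set). r) \<le> excess_sum v (l - r)"
    unfolding excess_sum_def by (intro sum_mono ex)
  then have S: "n * r \<le> excess_sum v (l - r)" by (simp add: n_def)
  have "excess_sq v (l - r) \<le> (\<Sum>i\<in>(UNIV::'n set). (r + D)\<^sup>2)"
    unfolding excess_sq_def by (intro sum_mono power_mono ex) (simp add: excess_def)
  then have Q: "excess_sq v (l - r) \<le> n * (r + D)\<^sup>2" by (simp add: n_def)
  have "t\<^sup>2 * excess_sq v (l - r) \<le> t\<^sup>2 * (n * (r + D)\<^sup>2)"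
    by (intro mult_left_mono Q) simp
  also have "\<dots> = n * (t * (r + D))\<^sup>2"
    by (simp add: power_mult_distrib)
  also have "\<dots> < n * (r * sqrt n)\<^sup>2"
    using n key assms(1) r D by (intro mult_strict_left_mono power_strict_mono) auto
  also have "\<dots> = (n * r)\<^sup>2"
    using n by (simp add: power_mult_distrib power2_eq_square)
  also have "\<dots> \<le> (excess_sum v (l - r))\<^sup>2"
    using n r by (intro power_mono S) simp
  finally have "phi t v (l - r) > 0" by (simp add: phi_eq)
  moreover have "l - r < v $ k" using l[of k] r by simp
  ultimately show thesis by (rule that[rotated])
qed

section \<open>The distinct values in decreasing order\<close>

lemma num_vals_pos: "num_vals v \<ge> 1"
  by (simp add: num_vals_def Suc_le_eq card_gt_0_iff)

lemma component_eq_lam: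
  obtains j where "j \<in> {1..num_vals v}" "v $ i = lam v j"
proof -
  have "v $ i \<in> lam v ` {1..num_vals v}" unfolding lam_image by simp
  with that show thesis by auto
qed

lemma lam_eq_component:
  assumes "j \<in> {1..num_vals v}"
  obtains i where "v $ i = lam v j"
proof -
  have "lam v j \<in> range (\<lambda>i. v $ i)" using assms unfolding lam_image[symmetric] by simp
  with that show thesis by auto
qed

lemma component_gap:
  assumes "1 < j" "j \<le> num_vals v" "lam v j < v $ i"
  shows "lam v (j - 1) \<le> v $ i"
proof -
  obtain m where m: "m \<in> {1..num_vals v}" "v $ i = lam v m" by (rule component_eq_lam)
  have "m < j"
  proof (rule ccontr)
    assume "\<not> m < j"
    then have "j = m \<or> lam v m < lam v j"
      using lam_strict_decreasing[of j m v] assms m by (cases "j = m") auto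
    with assms m show False by auto
  qed
  then have "m = j - 1 \<or> lam v (j - 1) < lam v m"
    using lam_strict_decreasing[of m "j - 1" v] assms m by (cases "m = j - 1") auto
  with m show ?thesis by auto
qed

lemma lam_one: "lam v 1 = vmax v"
proof -
  obtain i where i: "v $ i = vmax v" by (rule vmax_attained)
  obtain m where m: "m \<in> {1..num_vals v}" "v $ i = lam v m" by (rule component_eq_lam)
  obtain k where k: "v $ k = lam v 1"
    using num_vals_pos[of v] by (auto intro: lam_eq_component[of 1 v])
  have "lam v m \<le> lam v 1"
    using lam_strict_decreasing[of 1 m v] m by (cases "m = 1") auto
  with i m k vmax_ge[of v k] show ?thesis by simp
qed

lemma lam_less_vmax:
  assumes "1 < j" "j \<le> num_vals v"
  shows "lam v j < vmax v"
  using lam_strict_decreasing[of 1 j v] assms lam_one[of v] by simp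

lemma Icount_one: "Icount v 1 = card {i. v $ i \<ge> vmax v}"
  by (simp only: Icount_def lam_one)

lemma Icount_num_vals:
  fixes v :: "real ^ 'n"
  shows "Icount v (num_vals v) = CARD('n)"
proof -
  have "lam v (num_vals v) \<le> v $ i" for i
  proof -
    obtain m where "m \<in> {1..num_vals v}" "v $ i = lam v m" by (rule component_eq_lam)
    then show ?thesis
      using lam_strict_decreasing[of m "num_vals v" v] by (cases "m = num_vals v") auto
  qed
  then show ?thesis by (simp add: Icount_def)
qed

lemma jt_bounds:
  fixes v :: "real ^ 'n"
  assumes "t\<^sup>2 \<le> real CARD('n)" "real (Icount v 1) < t\<^sup>2"
  shows "1 < jt t v" "jt t v \<le> num_vals v"
    and "real (Icount v (jt t v - 1)) < t\<^sup>2"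
proof -
  let ?J = "{j \<in> {1..num_vals v}. real (Icount v j) \<ge> t\<^sup>2}"
  have "num_vals v \<in> ?J" using assms num_vals_pos[of v] by (simp add: Icount_num_vals)
  then have jt: "jt t v \<in> ?J" unfolding jt_def by (intro Min_in) auto
  with assms have "jt t v \<noteq> 1" by auto
  with jt show *: "1 < jt t v" "jt t v \<le> num_vals v" by auto
  have "jt t v - 1 \<notin> ?J"
  proof
    assume "jt t v - 1 \<in> ?J"
    then have "jt t v \<le> jt t v - 1" unfolding jt_def by (intro Min_le) auto
    with * show False by simp
  qed
  with * show "real (Icount v (jt t v - 1)) < t\<^sup>2" by auto
qed

text \<open>Components exceeding \<open>\<lambda>\<^bsub>j\<^sub>t\<^esub>\<close> are at least the next larger value, so they are counted by
  \<open>I\<^bsub>j\<^sub>t - 1\<^esub>\<close>, which is less than \<open>t\<^sup>2\<close> by the minimality of \<open>j\<^sub>t\<close>.\<close>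

lemma phi_neg_from_lam_jt:
  fixes v :: "real ^ 'n"
  assumes "t\<^sup>2 \<le> real CARD('n)" "real (Icount v 1) < t\<^sup>2"
    and "lam v (jt t v) \<le> \<mu>" "\<mu> < vmax v"
  shows "phi t v \<mu> < 0"
proof (rule phi_neg_if_few_exceed[OF assms(4)])
  note jt = jt_bounds[OF assms(1,2)]
  have "card {i. v $ i > \<mu>} \<le> Icount v (jt t v - 1)"
    unfolding Icount_def using component_gap[OF jt(1,2)] assms(3)
    by (intro card_mono) force+
  with jt(3) show "real (card {i. v $ i > \<mu>}) < t\<^sup>2" by linarith
qed

section \<open>The three cases\<close>

lemma phi_pos_if_many_maximal:
  fixes v :: "real ^ 'n"
  assumes "real (Icount v 1) > t\<^sup>2" "\<mu> < vmax v"
  shows "phi t v \<mu> > 0"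
proof -
  \<comment> \<open>A threshold in \<open>[\<mu>, v\<^sub>m\<^sub>a\<^sub>x)\<close> that only maximal components exceed; the sign at \<open>\<nu>\<close> carries
      over to \<open>\<mu>\<close> by monotonicity.\<close>
  define \<nu> where "\<nu> = Max (insert \<mu> {v $ i |i. v $ i < vmax v})"
  have fin: "finite (insert \<mu> {v $ i |i. v $ i < vmax v})" by simp
  have \<nu>: "\<mu> \<le> \<nu>" "\<And>i. v $ i < vmax v \<Longrightarrow> v $ i \<le> \<nu>"
    unfolding \<nu>_def by (intro Max_ge fin; blast)+
  have lt: "\<nu> < vmax v"
    using Max_in[OF fin] assms(2) unfolding \<nu>_def by auto
  have "real (Icount v 1) > 0"
    using assms(1) by (rule le_less_trans[rotated]) simp
  then have "phi t v \<nu> > 0"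
    using phi_top_level[of \<nu> v t, OF _ \<nu>(2)] lt assms(1) unfolding Icount_one by simp
  then show ?thesis
    using phi_pos_leftward[of \<mu> \<nu> v t] \<nu>(1) lt by (cases "\<mu> = \<nu>") auto
qed

lemma phi_if_exactly_maximal:
  fixes v :: "real ^ 'n"
  assumes "real (Icount v 1) = t\<^sup>2" "t\<^sup>2 < real CARD('n)"
  shows "\<mu> < lam v 2 \<Longrightarrow> phi t v \<mu> > 0"
    and "lam v 2 \<le> \<mu> \<Longrightarrow> \<mu> < vmax v \<Longrightarrow> phi t v \<mu> = 0"
proof -
  have "num_vals v \<noteq> 1"
    using assms Icount_num_vals[of v] by auto
  then have two: "2 \<le> num_vals v" using num_vals_pos[of v] by simp
  have lt: "lam v 2 < vmax v" using lam_less_vmax[of 2 v] two by simp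
  have gap: "v $ i \<le> lam v 2" if "v $ i < vmax v" for i
    using component_gap[of 2 v i] two that lam_one[of v] by force
  have zero: "phi t v \<mu> = 0" if "lam v 2 \<le> \<mu>" "\<mu> < vmax v" for \<mu>
  proof -
    have "v $ i \<le> \<mu>" if "v $ i < vmax v" for i
      using gap[OF that] \<open>lam v 2 \<le> \<mu>\<close> by simp
    then show ?thesis
      using phi_top_level[of \<mu> v t] that assms(1) unfolding Icount_one by simp
  qed
  then show "lam v 2 \<le> \<mu> \<Longrightarrow> \<mu> < vmax v \<Longrightarrow> phi t v \<mu> = 0" .
  assume \<mu>: "\<mu> < lam v 2"
  obtain k where "v $ k = lam v 2"
    using two by (auto intro: lam_eq_component[of 2 v])
  then show "phi t v \<mu> > 0"
    using phi_pos_left_of_nonneg[of \<mu> "lam v 2" v k t] \<mu> lt zero[of "lam v 2"] by simp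
qed

text \<open>For \<open>r < \<lambda>\<^bsub>j\<^sub>t\<^esub> < v\<^sub>m\<^sub>a\<^sub>x\<close>, the component \<open>\<lambda>\<^bsub>j\<^sub>t\<^esub>\<close> lies strictly between the root and the
  maximum, which is what strict monotonicity around \<open>r\<close> needs. The description of where \<open>\<phi>\<close> is
  positive covers all thresholds, including those from \<open>v\<^sub>m\<^sub>a\<^sub>x\<close> on, where \<open>\<phi>\<close> vanishes; so it
  applies to \<open>\<phi>(0)\<close> whatever the sign of \<open>v\<^sub>m\<^sub>a\<^sub>x\<close>.\<close>

lemma phi_root_if_few_maximal:
  fixes v :: "real ^ 'n"
  assumes "0 \<le> t" "t < sqrt (real CARD('n))" "real (Icount v 1) < t\<^sup>2"
  obtains r where "r < lam v (jt t v)" "lam v (jt t v) < vmax v"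
    and "\<And>\<mu>. \<mu> < vmax v \<Longrightarrow> phi t v \<mu> = 0 \<longleftrightarrow> \<mu> = r"
    and "\<And>\<mu>. phi t v \<mu> > 0 \<longleftrightarrow> \<mu> < r"
proof -
  let ?l = "lam v (jt t v)"
  have t2: "t\<^sup>2 \<le> real CARD('n)"
    using assms(1,2) power_strict_mono[of t "sqrt (real CARD('n))" 2] by simp
  note jt = jt_bounds[OF t2 assms(3)]
  have lt: "?l < vmax v" by (rule lam_less_vmax[OF jt(1,2)])
  have neg: "phi t v \<mu> < 0" if "?l \<le> \<mu>" "\<mu> < vmax v" for \<mu>
    by (rule phi_neg_from_lam_jt[OF t2 assms(3) that])
  obtain k where k: "v $ k = ?l"
    using jt by (auto intro: lam_eq_component[of "jt t v" v])
  obtain \<mu>0 where \<mu>0: "\<mu>0 < ?l" "phi t v \<mu>0 > 0"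
    using phi_pos_somewhere[OF assms(1,2), of v k] k by auto
  obtain r where r: "\<mu>0 \<le> r" "r \<le> ?l" "phi t v r = 0"
    using IVT2'[of "phi t v" ?l 0 \<mu>0] \<mu>0 neg[of ?l] lt continuous_on_phi by auto
  have rl: "r < ?l" using r neg[of ?l] lt by (cases "r = ?l") auto
  have left: "phi t v \<mu> > 0" if "\<mu> < r" for \<mu>
    using phi_pos_left_of_nonneg[of \<mu> r v k t] that r rl lt k by simp
  have right: "phi t v \<mu> < 0" if "r < \<mu>" "\<mu> < vmax v" for \<mu>
  proof (rule ccontr)
    assume nonneg: "\<not> phi t v \<mu> < 0"
    then have "phi t v r > 0"
      using phi_pos_left_of_nonneg[of r \<mu> v k t] that rl lt k by simp
    with r show False by simp
  qed
  show thesis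
  proof (rule that[OF rl lt])
    show "phi t v \<mu> = 0 \<longleftrightarrow> \<mu> = r" if "\<mu> < vmax v" for \<mu>
      using left[of \<mu>] right[of \<mu>] r(3) that by (cases \<mu> r rule: linorder_cases) auto
    show "phi t v \<mu> > 0 \<longleftrightarrow> \<mu> < r" for \<mu>
      using left[of \<mu>] right[of \<mu>] r(3) phi_zero_above[of v \<mu> t]
      by (cases \<mu> r rule: linorder_cases; cases "\<mu> < vmax v") auto
  qed
qed

theorem proposition3p4:
  fixes t :: real and v :: "real ^ 'n"
  assumes "CARD('n) \<ge> 2"
    and "1 \<le> t" and "t < sqrt (real CARD('n))"
  shows "(real (Icount v 1) > t\<^sup>2 \<longrightarrow> (\<forall>\<mu>\<in>{..<vmax v}. phi t v \<mu> > 0)) \<and>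
         (real (Icount v 1) = t\<^sup>2 \<longrightarrow>
           (\<forall>\<mu>\<in>{..<lam v 2}. phi t v \<mu> > 0) \<and>
           (\<forall>\<mu>\<in>{lam v 2..<vmax v}. phi t v \<mu> = 0)) \<and>
         (real (Icount v 1) < t\<^sup>2 \<longrightarrow>
           (\<exists>!\<mu>. \<mu> \<in> {..<vmax v} \<and> phi t v \<mu> = 0) \<and>
           (\<forall>\<mu>\<in>{..<vmax v}. phi t v \<mu> = 0 \<longrightarrow> \<mu> \<in> {..<lam v (jt t v)}) \<and>
           ((\<exists>!\<mu>. \<mu> \<in> {0<..<vmax v} \<and> phi t v \<mu> = 0) \<longleftrightarrow> phi t v 0 > 0))"
proof (intro conjI impI)
  assume "real (Icount v 1) > t\<^sup>2"
  then show "\<forall>\<mu>\<in>{..<vmax v}. phi t v \<mu> > 0"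
    by (simp add: phi_pos_if_many_maximal)
next
  have t2: "t\<^sup>2 < real CARD('n)"
    using assms(2,3) power_strict_mono[of t "sqrt (real CARD('n))" 2] by simp
  assume eq: "real (Icount v 1) = t\<^sup>2"
  show "\<forall>\<mu>\<in>{..<lam v 2}. phi t v \<mu> > 0"
    using phi_if_exactly_maximal(1)[OF eq t2] by simp
  show "\<forall>\<mu>\<in>{lam v 2..<vmax v}. phi t v \<mu> = 0"
    using phi_if_exactly_maximal(2)[OF eq t2] by simp
next
  assume few: "real (Icount v 1) < t\<^sup>2"
  have "0 \<le> t" using assms(2) by simp
  from phi_root_if_few_maximal[OF this assms(3) few]
  obtain r where r: "r < lam v (jt t v)" "lam v (jt t v) < vmax v"
    and root: "\<And>\<mu>. \<mu> < vmax v \<Longrightarrow> phi t v \<mu> = 0 \<longleftrightarrow> \<mu> = r"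
    and pos: "\<And>\<mu>. phi t v \<mu> > 0 \<longleftrightarrow> \<mu> < r"
    by metis
  have rv: "r < vmax v" using r by simp
  show "\<exists>!\<mu>. \<mu> \<in> {..<vmax v} \<and> phi t v \<mu> = 0"
    using root rv by auto
  show "\<forall>\<mu>\<in>{..<vmax v}. phi t v \<mu> = 0 \<longrightarrow> \<mu> \<in> {..<lam v (jt t v)}"
    using root r by auto
  show "(\<exists>!\<mu>. \<mu> \<in> {0<..<vmax v} \<and> phi t v \<mu> = 0) \<longleftrightarrow> phi t v 0 > 0"
    unfolding pos using root rv by auto
qed

end
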